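(* Let $K\subsetneq L$ be a field extension, and let $A,B\subseteq L$ be $n$-dimensional $K$-subspaces with $0 < n < \infty$ and $1\notin B$. For a basis $\mathcal{A}=\{a_1,\dots,a_n\}$ of $A$ and for $i\in [n]$, define the $K$-subspace $$T_i(\mathcal{A}) = a_i^{-1}A\cap B \subseteq B.$$ Define $$\Omega(\mathcal{A}) = \max_{J\subseteq [n]}\Bigl(|J|+\dim \bigcap_{i\in J}T_i(\mathcal{A}) - n\Bigr),$$ where the intersection is understood to equal $B$ when $J = \emptyset$. Then: (i) $\Omega(\mathcal{A})$ equals the least integer $d\ge 0$ for which there exists a basis $\mathcal{B}=\{b_1,\dots,b_n\}$ of $B$ such that $\mathcal{A}$ is partially matched to $\mathcal{B}$ with defect $d$. (ii) Consequently, $$\delta(A,B)=\max_{\mathcal{A}} \Omega(\mathcal{A}),$$ where $\mathcal{A}$ runs over all ordered bases of $A$.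
   Context: Fields are commutative. All dimensions are over $K$. $[n]=\{1,\dots,n\}$, and $\langle X\rangle$ denotes the $K$-span of a set $X$. Definition (partial matching of bases). Let $A,B$ be $n$-dimensional $K$-subspaces of $L$, $n\ge 1$, and $0\le d\le n$ an integer. An ordered basis $\mathcal{A}=\{a_1,\dots,a_n\}$ of $A$ is partially matched to an ordered basis $\mathcal{B}=\{b_1,\dots,b_n\}$ of $B$ with defect $d$ if there exists $P\subseteq[n]$ with $|P|=n-d$ such that $$a_i^{-1}A\cap B\subseteq \langle b_1,\dots,b_{i-1},b_{i+1},\dots,b_n\rangle\quad\text{for each } i\in P.$$ Definition (partial matching of subspaces). $A$ is partially matched to $B$ with defect $d$ if for every ordered basis $\mathcal{A}$ of $A$ there exists an ordered basis $\mathcal{B}$ of $B$ such that $\mathcal{A}$ is partially matched to $\mathcal{B}$ with defect $d$. Definition (deficiency). For $n$-dimensional $A,B$ with $0<n<\infty$ and $1\notin B$, $\delta(A,B)$ is the least nonnegative integer $d$ for which $A$ is partially matched to $B$ with defect $d$. *)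

theory Defs
  imports Complex_Main
begin

text \<open>A field extension \<open>K \<subseteq> L\<close> is given by two field types and a homomorphism \<open>emb\<close> of the
  field \<open>K\<close> into the field \<open>L\<close> (automatically injective); \<open>K\<close> is identified with \<open>range emb\<close>, so
  \<open>K \<noteq> L\<close> means \<open>range emb \<noteq> UNIV\<close>.\<close>

definition ext_scale :: "('k::field \<Rightarrow> 'l::field) \<Rightarrow> 'k \<Rightarrow> 'l \<Rightarrow> 'l" where
  "ext_scale emb c x = emb c * x"

locale field_extension =
  fixes emb :: "'k::field \<Rightarrow> 'l::field"
  assumes emb_add: "emb (x + y) = emb x + emb y"
    and emb_mult: "emb (x * y) = emb x * emb y"
    and emb_one: "emb 1 = 1"

sublocale field_extension \<subseteq> vector_space "ext_scale emb"
  by unfold_locales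
    (simp_all add: ext_scale_def emb_add emb_mult emb_one algebra_simps)

context field_extension
begin

text \<open>Ordered bases are indexed by \<open>{1..n}\<close>; the values of \<open>a\<close> outside \<open>{1..n}\<close> are never used.\<close>

definition ordered_basis :: "nat \<Rightarrow> 'l set \<Rightarrow> (nat \<Rightarrow> 'l) \<Rightarrow> bool" where
  "ordered_basis n S a \<longleftrightarrow>
     inj_on a {1..n} \<and> independent (a ` {1..n}) \<and> span (a ` {1..n}) = S"

definition T :: "'l set \<Rightarrow> 'l set \<Rightarrow> (nat \<Rightarrow> 'l) \<Rightarrow> nat \<Rightarrow> 'l set" where
  "T A B a i = (\<lambda>x. inverse (a i) * x) ` A \<inter> B"

definition basis_partially_matched ::
    "nat \<Rightarrow> 'l set \<Rightarrow> 'l set \<Rightarrow> (nat \<Rightarrow> 'l) \<Rightarrow> (nat \<Rightarrow> 'l) \<Rightarrow> nat \<Rightarrow> bool" where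
  "basis_partially_matched n A B a b d \<longleftrightarrow>
     d \<le> n \<and>
     (\<exists>P \<subseteq> {1..n}. card P = n - d \<and>
        (\<forall>i\<in>P. (\<lambda>x. inverse (a i) * x) ` A \<inter> B \<subseteq> span (b ` ({1..n} - {i}))))"

definition partially_matched :: "nat \<Rightarrow> 'l set \<Rightarrow> 'l set \<Rightarrow> nat \<Rightarrow> bool" where
  "partially_matched n A B d \<longleftrightarrow>
     (\<forall>a. ordered_basis n A a \<longrightarrow>
        (\<exists>b. ordered_basis n B b \<and> basis_partially_matched n A B a b d))"

text \<open>The minimum exists for \<open>n\<close>-dimensional \<open>A\<close> and \<open>B\<close>: with \<open>P = {}\<close>, defect \<open>n\<close> always works.\<close>

definition deficiency :: "nat \<Rightarrow> 'l set \<Rightarrow> 'l set \<Rightarrow> nat" where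
  "deficiency n A B = (LEAST d. partially_matched n A B d)"

text \<open>The quantity inside the maximum may be negative for individual \<open>J\<close>, hence the integers.\<close>

definition \<Omega> :: "nat \<Rightarrow> 'l set \<Rightarrow> 'l set \<Rightarrow> (nat \<Rightarrow> 'l) \<Rightarrow> int" where
  "\<Omega> n A B a =
     Max ((\<lambda>J. int (card J) + int (dim (if J = {} then B else (\<Inter>i\<in>J. T A B a i))) - int n)
          ` Pow {1..n})"

end

end

(* A basis b of B with T_i contained in the span of the b_j, j /= i, for all i in P amounts to a
   linearly independent family of functionals f_i, i in P, with f_i in the annihilator of T_i.
   Hence the first part is the defect form of Rado's theorem on independent transversals for
   these annihilators, in the dual space of B. Stated without duals: if
   |J| + dim (\<Inter>i\<in>J. T i) \<le> n + d for all J, then the T_i can be enlarged, keeping this bound,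
   until each is a hyperplane or B itself. A minimal P with the same intersection W as the whole
   family then has at least n - d elements, and vectors b_i outside T_i but in T_j for all other
   j in P, together with a basis of W, form a basis of B. *)
theory Submission
  imports Defs
begin

section \<open>Dimension counts and exchange arguments inside a finitely spanned subspace\<close>

context vector_space
begin

text \<open>The ambient space may be infinite-dimensional, and \<open>dim\<close> takes the value 0
  on sets without a finite basis. Containment in \<open>span F\<close> with \<open>F\<close> finite
  is therefore carried through all the dimension counts.\<close>

lemma finite_span_subset:
  assumes "V \<subseteq> span F" "finite F"
  obtains C where "finite C" "C \<subseteq> V" "independent C" "V \<subseteq> span C" "card C = dim V"
  by (metis assms basis_exists independent_span_bound subset_trans)

lemma card_independent_le_dim:
  assumes "independent C" "C \<subseteq> V" "V \<subseteq> span F" "finite F"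
  shows "card C \<le> dim V"
proof -
  obtain D where "finite D" "V \<subseteq> span D" "card D = dim V"
    using finite_span_subset[OF assms(3,4)] by metis
  with independent_span_bound[of D C] assms(1,2) show ?thesis by auto
qed

lemma dim_mono_finite:
  assumes "U \<subseteq> V" "V \<subseteq> span F" "finite F"
  shows "dim U \<le> dim V"
proof -
  obtain D where "finite D" "V \<subseteq> span D" "card D = dim V"
    using finite_span_subset[OF assms(2,3)] by metis
  with dim_le_card[of U D] assms(1) show ?thesis by auto
qed

lemma dim_insert_finite:
  assumes "subspace U" "x \<notin> U" "insert x U \<subseteq> span F" "finite F"
  shows "dim U < dim (span (insert x U))"
proof -
  have "U \<subseteq> span F" using assms by auto
  then obtain C where C: "finite C" "C \<subseteq> U" "independent C" "U \<subseteq> span C" "card C = dim U"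
    using finite_span_subset assms(4) by metis
  have xC: "x \<notin> span C"
    using C(2) assms(1,2) span_minimal by blast
  then have "independent (insert x C)" "x \<notin> C"
    using C(3) by (auto simp: independent_insert intro: span_base)
  moreover have "insert x C \<subseteq> span (insert x U)"
    using C(2) by (auto intro: span_base)
  moreover have "span (insert x U) \<subseteq> span F"
    using assms(3) by (simp add: span_minimal)
  ultimately have "card (insert x C) \<le> dim (span (insert x U))"
    using card_independent_le_dim assms(4) by blast
  with C \<open>x \<notin> C\<close> show ?thesis by simp
qed

text \<open>A basis \<open>C\<close> of \<open>U \<inter> V\<close> extends to a basis
  \<open>D\<close> of \<open>V\<close>, and a basis \<open>E\<close> of \<open>U\<close> stays
  independent when \<open>D - C\<close> is added. Any \<open>X\<close> containing both subspaces
  takes the place of \<open>U + V\<close>.\<close>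

lemma dim_add_le:
  assumes U: "subspace U" and V: "subspace V"
    and sub: "U \<union> V \<subseteq> X" and X: "X \<subseteq> span F" "finite F"
  shows "dim U + dim V \<le> dim X + dim (U \<inter> V)"
proof -
  have sp: "U \<subseteq> span F" "U \<inter> V \<subseteq> span F" "V \<subseteq> span F" using sub X by auto
  obtain C where C: "finite C" "C \<subseteq> U \<inter> V" "independent C" "U \<inter> V \<subseteq> span C" "card C = dim (U \<inter> V)"
    using finite_span_subset[OF sp(2) X(2)] by metis
  obtain D where D: "C \<subseteq> D" "D \<subseteq> V" "independent D" "V \<subseteq> span D"
    using maximal_independent_subset_extend C(2,3) by (metis le_inf_iff)
  have finD: "finite D" using D independent_span_bound[OF X(2)] sp by blast
  have cardD: "card D = dim V" using D basis_card_eq_dim by blast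
  obtain E where E: "finite E" "E \<subseteq> U" "independent E" "U \<subseteq> span E" "card E = dim U"
    using finite_span_subset[OF sp(1) X(2)] by metis
  have "independent (E \<union> G) \<and> card (E \<union> G) = card E + card G" if "finite G" "G \<subseteq> D - C" for G
    using that
  proof (induction G rule: finite_induct)
    case empty
    then show ?case using E by simp
  next
    case (insert e G)
    \<comment> \<open>If \<open>e = u + w\<close>, then \<open>u = e - w\<close> lies in
      \<open>U \<inter> V\<close>, hence in \<open>span C\<close>. This would express
      \<open>e\<close> through the other members of \<open>D\<close>.\<close>
    have "e \<notin> span (E \<union> G)"
    proof
      assume "e \<in> span (E \<union> G)"
      then obtain u w where uw: "e = u + w" "u \<in> span E" "w \<in> span G"
        unfolding span_Un by auto
      have "u \<in> U" using uw(2) E(2) U span_minimal by blast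
      moreover have "w \<in> V" using uw(3) insert.prems D(2) V span_minimal[of G V] by blast
      moreover have "e \<in> V" using insert.prems D(2) by auto
      ultimately have "u \<in> U \<inter> V" using uw(1) V by (metis IntI add_diff_cancel_right' subspace_diff)
      then have "u \<in> span (D - {e})"
        using C(4) span_mono[of C "D - {e}"] D(1) insert.prems by blast
      moreover have "w \<in> span (D - {e})"
        using uw(3) span_mono[of G "D - {e}"] insert by blast
      ultimately have "e \<in> span (D - {e})" using uw(1) span_add by blast
      then show False using D(3) insert.prems unfolding dependent_def by blast
    qed
    moreover then have "e \<notin> E \<union> G" using span_base by blast
    ultimately show ?case
      using insert E(1) by (simp add: independent_insert)
  qed
  from this[of "D - C"] finD
  have G: "independent (E \<union> (D - C))" "card (E \<union> (D - C)) = card E + card (D - C)" by auto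
  have "card (E \<union> (D - C)) \<le> dim X"
    using card_independent_le_dim[OF G(1) _ X] E(2) D(2) sub by blast
  moreover have "card D = card C + card (D - C)"
    using D(1) finD C(1) by (metis add_diff_inverse_nat card_Diff_subset card_mono not_less)
  ultimately show ?thesis using G(2) E(5) C(5) cardD by simp
qed

text \<open>The coordinates of \<open>x\<close> in the basis \<open>X\<close> of its span are
  unique, so those at the elements of \<open>Y\<close> vanish simultaneously once each vanishes
  separately. The induction replaces coordinates by the exchange property.\<close>

lemma in_span_Diff:
  assumes ind: "independent X" and "finite Y" and x: "x \<in> span X"
    and Y: "\<And>y. y \<in> Y \<Longrightarrow> x \<in> span (X - {y})"
  shows "x \<in> span (X - Y)"
  using assms(2) Y
proof (induction Y rule: finite_induct)
  case empty
  then show ?case using x by simp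
next
  case (insert y Y)
  show ?case
  proof (rule ccontr)
    assume n: "x \<notin> span (X - insert y Y)"
    have xY: "x \<in> span (X - Y)" using insert by auto
    have yX: "y \<in> X - Y" using n xY by (metis Diff_insert Diff_insert0 Diff_empty)
    then have "X - Y = insert y (X - insert y Y)" by auto
    with xY have "x \<in> span (insert y (X - insert y Y))" by simp
    then have "y \<in> span (insert x (X - insert y Y))" using in_span_insert n by blast
    moreover have "insert x (X - insert y Y) \<subseteq> span (X - {y})"
      using insert.prems by (auto intro: span_base)
    ultimately have "y \<in> span (X - {y})" by (metis span_minimal subset_iff subspace_span)
    then show False using ind yX unfolding dependent_def by blast
  qed
qed

text \<open>By exchange, a common vector \<open>z\<close> outside \<open>U\<close> would satisfy
  \<open>x \<in> span (insert z U)\<close>, which is contained in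
  \<open>span (insert y U)\<close>.\<close>

lemma span_insert_Int:
  assumes "subspace U" and x: "x \<notin> span (insert y U)"
  shows "span (insert x U) \<inter> span (insert y U) = U"
proof
  show "U \<subseteq> span (insert x U) \<inter> span (insert y U)" by (auto intro: span_base)
  show "span (insert x U) \<inter> span (insert y U) \<subseteq> U"
  proof
    fix z assume z: "z \<in> span (insert x U) \<inter> span (insert y U)"
    show "z \<in> U"
    proof (rule ccontr)
      assume "z \<notin> U"
      then have "z \<notin> span U" using assms(1) span_eq_iff by blast
      then have "x \<in> span (insert z U)" using z in_span_insert by blast
      moreover have "insert z U \<subseteq> span (insert y U)" using z by (auto intro: span_base)
      ultimately show False using x by (metis span_minimal subset_iff subspace_span)
    qed
  qed
qed

section \<open>Enlargement to hyperplanes and the basis dual to them\<close>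

text \<open>A subspace \<open>T i\<close> of codimension at least two has two enlargements by one dimension that meet
  in \<open>T i\<close>, and submodularity of dimension excludes that both violate the bound. The bound is
  required for all \<open>J\<close> as the induction needs it, although only \<open>J = I\<close> matters in the end.\<close>

lemma enlarge_to_hyperplanes:
  assumes B: "subspace B" "B \<subseteq> span F" "finite F" and I: "finite I"
    and "\<And>i. i \<in> I \<Longrightarrow> subspace (T i)" "\<And>i. i \<in> I \<Longrightarrow> T i \<subseteq> B"
    and "\<And>J. J \<subseteq> I \<Longrightarrow> card J + dim (B \<inter> (\<Inter>i\<in>J. T i)) \<le> c"
  shows "\<exists>H. (\<forall>i\<in>I. subspace (H i) \<and> T i \<subseteq> H i \<and> H i \<subseteq> B \<and> (\<forall>y\<in>B - H i. B \<subseteq> span (insert y (H i))))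
           \<and> card I + dim (B \<inter> (\<Inter>i\<in>I. H i)) \<le> c"
  using assms(5-7)
\<comment> \<open>Induction on the total codimension in \<open>B\<close>. The case condition below
  says that every \<open>T i\<close> is a hyperplane of \<open>B\<close> or \<open>B\<close>
  itself.\<close>
proof (induction "\<Sum>i\<in>I. dim B - dim (T i)" arbitrary: T rule: less_induct)
  case less
  show ?case
  proof (cases "\<forall>i\<in>I. \<forall>y\<in>B - T i. B \<subseteq> span (insert y (T i))")
    case True
    then show ?thesis using less.prems by (intro exI[of _ T]) auto
  next
    case False
    \<comment> \<open>\<open>x\<close> and \<open>y\<close> are independent modulo
      \<open>T i\<close>; adjoining one or the other gives the two candidate enlargements.\<close>
    then obtain i x y where i: "i \<in> I" and y: "y \<in> B" "y \<notin> T i"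
      and x: "x \<in> B" "x \<notin> span (insert y (T i))" by blast
    have xT: "x \<notin> T i" using x(2) by (auto intro: span_base)
    let ?U = "\<lambda>z. T(i := span (insert z (T i)))"
    let ?m = "\<lambda>J. B \<inter> (\<Inter>j\<in>J. T j)"
    have step: ?thesis
      if z: "z \<in> B" "z \<notin> T i" and ok: "\<forall>J\<subseteq>I. card J + dim (B \<inter> (\<Inter>j\<in>J. ?U z j)) \<le> c" for z
    proof -
      have sB: "span (insert z (T i)) \<subseteq> B"
        using z i less.prems(2) B(1) by (simp add: span_minimal)
      have "dim (T i) < dim (span (insert z (T i)))"
        using dim_insert_finite[of "T i" z F] less.prems(1,2) i z B by blast
      moreover have "dim (span (insert z (T i))) \<le> dim B"
        using dim_mono_finite sB B by blast
      ultimately have "(\<Sum>j\<in>I. dim B - dim (?U z j)) < (\<Sum>j\<in>I. dim B - dim (T j))"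
        using i I by (intro sum_strict_mono_ex1) auto
      then have "\<exists>H. (\<forall>j\<in>I. subspace (H j) \<and> ?U z j \<subseteq> H j \<and> H j \<subseteq> B \<and>
            (\<forall>y\<in>B - H j. B \<subseteq> span (insert y (H j))))
          \<and> card I + dim (B \<inter> (\<Inter>j\<in>I. H j)) \<le> c"
      proof (rule less.hyps)
        show "subspace (?U z j)" if "j \<in> I" for j using that less.prems(1) by simp
        show "?U z j \<subseteq> B" if "j \<in> I" for j using that less.prems(2) sB by simp
        show "card J + dim (B \<inter> (\<Inter>j\<in>J. ?U z j)) \<le> c" if "J \<subseteq> I" for J using that ok by blast
      qed
      then obtain H where H: "\<forall>j\<in>I. subspace (H j) \<and> ?U z j \<subseteq> H j \<and> H j \<subseteq> B \<and>
            (\<forall>y\<in>B - H j. B \<subseteq> span (insert y (H j)))"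
        "card I + dim (B \<inter> (\<Inter>j\<in>I. H j)) \<le> c"
        by blast
      have "T j \<subseteq> ?U z j" for j by (auto intro: span_base)
      with H show ?thesis by (intro exI[of _ H]) blast
    qed
    \<comment> \<open>Only \<open>T i\<close> was changed, so a violating index set must contain
      \<open>i\<close>. Removing \<open>i\<close> from it turns the strict inequality into a weak
      one.\<close>
    have bad: "\<exists>J\<subseteq>I - {i}. c \<le> card J + dim (?m J \<inter> span (insert z (T i)))"
      if fail: "\<not> (\<forall>J\<subseteq>I. card J + dim (B \<inter> (\<Inter>j\<in>J. ?U z j)) \<le> c)" for z
    proof -
      obtain J where J: "J \<subseteq> I" "c < card J + dim (B \<inter> (\<Inter>j\<in>J. ?U z j))"
        using fail by (auto simp: not_le)
      have iJ: "i \<in> J"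
      proof (rule ccontr)
        assume "i \<notin> J"
        then have "(\<Inter>j\<in>J. ?U z j) = (\<Inter>j\<in>J. T j)" by auto
        with J less.prems(3)[OF J(1)] show False by simp
      qed
      have eq: "B \<inter> (\<Inter>j\<in>J. ?U z j) = ?m (J - {i}) \<inter> span (insert z (T i))"
        using iJ by (auto split: if_splits)
      have "card J = Suc (card (J - {i}))"
        using iJ J(1) I by (metis card.remove finite_subset)
      with J(2) eq have "c \<le> card (J - {i}) + dim (?m (J - {i}) \<inter> span (insert z (T i)))" by simp
      with J(1) show ?thesis by (intro exI[of _ "J - {i}"]) auto
    qed
    show ?thesis
    proof (rule ccontr)
      assume no: "\<not> ?thesis"
      obtain J where J: "J \<subseteq> I - {i}" "c \<le> card J + dim (?m J \<inter> span (insert x (T i)))"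
        using bad[of x] step[of x] no x(1) xT by blast
      obtain J' where J': "J' \<subseteq> I - {i}" "c \<le> card J' + dim (?m J' \<inter> span (insert y (T i)))"
        using bad[of y] step[of y] no y by blast
      have fJ: "finite J" "finite J'" using J J' I finite_subset by blast+
      have subm: "subspace (?m Q)" if "Q \<subseteq> I" for Q
        using that less.prems(1) by (intro subspace_inter B subspace_Int) auto
      let ?S = "?m J \<inter> span (insert x (T i))" and ?S' = "?m J' \<inter> span (insert y (T i))"
      have "?S \<inter> ?S' = ?m J \<inter> ?m J' \<inter> (span (insert x (T i)) \<inter> span (insert y (T i)))" by blast
      also have "\<dots> = ?m J \<inter> ?m J' \<inter> T i"
        using span_insert_Int[OF less.prems(1)[OF i] x(2)] by simp
      also have "\<dots> = ?m (insert i (J \<union> J'))" by auto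
      finally have int: "?S \<inter> ?S' = ?m (insert i (J \<union> J'))" .
      \<comment> \<open>Adding the two violations bounds \<open>2 * c\<close> from above by the
        bounds for \<open>J \<inter> J'\<close> and \<open>insert i (J \<union> J')\<close>. The
        extra index \<open>i\<close> makes the total at most \<open>2 * c - 1\<close>.\<close>
      have "dim ?S + dim ?S' \<le> dim (?m (J \<inter> J')) + dim (?S \<inter> ?S')"
        using J(1) J'(1) B by (intro dim_add_le[where F = F] subspace_inter subspace_span subm) auto
      moreover have "card (J \<inter> J') + dim (?m (J \<inter> J')) \<le> c"
        using J(1) by (intro less.prems(3)) auto
      moreover have "card (insert i (J \<union> J')) + dim (?S \<inter> ?S') \<le> c"
        unfolding int using J(1) J'(1) i by (intro less.prems(3)) auto
      moreover have "card (insert i (J \<union> J')) = Suc (card (J \<union> J'))"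
        using fJ J(1) J'(1) by (subst card_insert_disjoint) auto
      moreover have "card (J \<union> J') + card (J \<inter> J') = card J + card J'"
        using card_Un_Int fJ by metis
      ultimately show False using J(2) J'(2) by linarith
    qed
  qed
qed

text \<open>Minimality of \<open>P\<close> discards redundant hyperplanes and every
  \<open>H i\<close> equal to \<open>B\<close>. The remaining ones are kernels of independent
  functionals, to which the \<open>b i\<close> are dual up to scalars.\<close>

lemma hyperplanes_dual_basis:
  assumes B: "subspace B" "B \<subseteq> span F" "finite F" and I: "finite I"
    and H: "\<And>i. i \<in> I \<Longrightarrow> subspace (H i)" "\<And>i. i \<in> I \<Longrightarrow> H i \<subseteq> B"
      "\<And>i y. i \<in> I \<Longrightarrow> y \<in> B - H i \<Longrightarrow> B \<subseteq> span (insert y (H i))"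
  obtains P b C where "P \<subseteq> I" "inj_on b P" "b ` P \<inter> C = {}" "finite C"
    "independent (b ` P \<union> C)" "span (b ` P \<union> C) = B"
    "card C = dim (B \<inter> (\<Inter>i\<in>I. H i))" "\<And>i. i \<in> P \<Longrightarrow> H i \<subseteq> span (b ` (P - {i}) \<union> C)"
proof -
  let ?m = "\<lambda>J. B \<inter> (\<Inter>j\<in>J. H j)"
  obtain P where P: "P \<subseteq> I" "?m P = ?m I"
    and min: "\<And>Q. Q \<subseteq> I \<Longrightarrow> ?m Q = ?m I \<Longrightarrow> card P \<le> card Q"
    using ex_has_least_nat[of "\<lambda>Q. Q \<subseteq> I \<and> ?m Q = ?m I" I card] by auto
  have finP: "finite P" using P I finite_subset by blast
  \<comment> \<open>Without such a vector, \<open>i\<close> could be dropped from \<open>P\<close>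
    without changing the intersection.\<close>
  have "\<exists>v. v \<in> ?m (P - {i}) \<and> v \<notin> H i" if i: "i \<in> P" for i
  proof (rule ccontr)
    assume "\<not> ?thesis"
    then have "?m (P - {i}) = ?m P" by auto
    then have "card P \<le> card (P - {i})" using min[of "P - {i}"] P by auto
    then show False using i finP by (metis card_Diff1_less not_le)
  qed
  then obtain b where b: "\<And>i. i \<in> P \<Longrightarrow> b i \<in> ?m (P - {i})" "\<And>i. i \<in> P \<Longrightarrow> b i \<notin> H i" by metis
  have bH: "b j \<in> H i" if "i \<in> P" "j \<in> P" "j \<noteq> i" for i j using b(1)[of j] that by auto
  have bB: "b i \<in> B" if "i \<in> P" for i using b(1) that by auto
  have "?m P \<subseteq> span F" using B by auto
  then obtain C where C: "finite C" "C \<subseteq> ?m P" "independent C" "?m P \<subseteq> span C" "card C = dim (?m P)"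
    using finite_span_subset B(3) by metis
  have inj: "inj_on b P" using b(2) bH unfolding inj_on_def by metis
  have disj: "b ` P \<inter> C = {}" using b(2) C(2) by blast
  have spanH: "span (b ` (P - {i}) \<union> C) \<subseteq> H i" if "i \<in> P" for i
    using that bH C(2) H(1) P(1) by (intro span_minimal) auto
  have ind: "independent (b ` Q \<union> C)" if "finite Q" "Q \<subseteq> P" for Q
    using that
  proof (induction Q rule: finite_induct)
    case (insert i Q)
    have "b ` Q \<union> C \<subseteq> b ` (P - {i}) \<union> C" using insert by auto
    then have "b i \<notin> span (b ` Q \<union> C)"
      using spanH[of i] b(2)[of i] insert.prems span_mono by blast
    then show ?case using insert by (simp add: independent_insert)
  qed (simp add: C)
  \<comment> \<open>The constraints are released one at a time: subtracting a multiple of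
    \<open>b i\<close> moves \<open>x\<close> into \<open>H i\<close> and keeps it in the other
    \<open>H j\<close>. For \<open>Q = P\<close> the left side is \<open>B\<close>.\<close>
  have gen: "?m (P - Q) \<subseteq> span (b ` Q \<union> C)" if "finite Q" "Q \<subseteq> P" for Q
    using that
  proof (induction Q rule: finite_induct)
    case (insert i Q)
    show ?case
    proof
      fix x assume x: "x \<in> ?m (P - insert i Q)"
      have i: "i \<in> P" "i \<in> I" using insert.prems P by auto
      have "x \<in> span (insert (b i) (H i))" using H(3)[OF i(2)] b(2) bB i x by blast
      then obtain k where k: "x - scale k (b i) \<in> span (H i)" using span_breakdown_eq by auto
      then have "x - scale k (b i) \<in> H i" using H(1) i span_eq_iff by metis
      moreover have "x - scale k (b i) \<in> H j" if "j \<in> P - insert i Q" for j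
        using that x H(1) P bH i by (intro subspace_diff subspace_scale) auto
      moreover have "x - scale k (b i) \<in> B"
        using x bB i B(1) by (intro subspace_diff subspace_scale) auto
      ultimately have "x - scale k (b i) \<in> ?m (P - Q)" by blast
      then have "x - scale k (b i) \<in> span (b ` Q \<union> C)" using insert by blast
      then show "x \<in> span (b ` insert i Q \<union> C)" by (auto simp: span_breakdown_eq)
    qed
  qed (simp add: C)
  have sp: "span (b ` P \<union> C) = B"
  proof
    show "span (b ` P \<union> C) \<subseteq> B" using bB C(2) B(1) by (intro span_minimal) auto
    show "B \<subseteq> span (b ` P \<union> C)" using gen[of P] finP by simp
  qed
  \<comment> \<open>Omitting \<open>b i\<close> from a spanning set of \<open>B\<close> leaves
    codimension at most one, so a vector of \<open>H i\<close> outside this span would by exchange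
    force \<open>b i\<close> into \<open>H i\<close>.\<close>
  have "H i \<subseteq> span (b ` (P - {i}) \<union> C)" if i: "i \<in> P" for i
  proof (rule ccontr)
    assume "\<not> ?thesis"
    then obtain x where x: "x \<in> H i" "x \<notin> span (b ` (P - {i}) \<union> C)" by blast
    have "b ` P \<union> C = insert (b i) (b ` (P - {i}) \<union> C)" using i by auto
    then have "x \<in> span (insert (b i) (b ` (P - {i}) \<union> C))" using sp x(1) H(2) i P by auto
    then have "b i \<in> span (insert x (b ` (P - {i}) \<union> C))" using x(2) in_span_insert by blast
    moreover have "span (insert x (b ` (P - {i}) \<union> C)) \<subseteq> H i"
      using x(1) i bH C(2) H(1) P(1) by (intro span_minimal) auto
    ultimately show False using b(2) i by blast
  qed
  with P inj disj ind[of P] finP sp C(1,5) show thesis by (intro that[of P b C]) auto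
qed

end

section \<open>Matched bases and the bound on intersections of the \<open>T i\<close>\<close>

context field_extension
begin

lemma subspace_T:
  assumes "subspace A" "subspace B"
  shows "subspace (T A B a i)"
proof -
  have "subspace ((\<lambda>x. inverse (a i) * x) ` A)"
    using assms(1) unfolding subspace_def ext_scale_def image_iff
    by (simp add: Bex_def) (metis distrib_left mult.left_commute)
  then show ?thesis unfolding T_def using assms(2) subspace_inter by blast
qed

lemma T_subset: "T A B a i \<subseteq> B"
  by (auto simp: T_def)

text \<open>An empty intersection is \<open>UNIV\<close>, so meeting with \<open>B\<close> absorbs
  the special case \<open>J = {}\<close>.\<close>

lemma Inter_T_eq:
  "(if J = {} then B else (\<Inter>i\<in>J. T A B a i)) = B \<inter> (\<Inter>i\<in>J. T A B a i)"
  using T_subset by (auto, blast)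

lemma card_ordered_basis_image:
  "ordered_basis n S b \<Longrightarrow> J \<subseteq> {1..n} \<Longrightarrow> card (b ` J) = card J"
  by (meson card_image inj_on_subset ordered_basis_def)

lemma ordered_basis_exists:
  assumes "subspace V" "dim V = n" "0 < n"
  shows "\<exists>b. ordered_basis n V b"
proof -
  obtain C where C: "C \<subseteq> V" "independent C" "V \<subseteq> span C" "card C = dim V"
    using basis_exists by blast
  \<comment> \<open>Positivity of \<open>n\<close> matters here: an infinite set has
    \<open>card\<close> 0.\<close>
  have "finite C" using C assms card_gt_0_iff by metis
  then obtain b where "bij_betw b {1..n} C"
    using C(4) assms(2) by (metis bij_betw_iff_card card_atLeastAtMost diff_Suc_1 finite_atLeastAtMost)
  moreover have "span C = V" using C assms(1) span_subspace by blast
  ultimately show ?thesis using C(2) unfolding ordered_basis_def bij_betw_def by blast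
qed

lemma basis_partially_matched_mono:
  assumes "basis_partially_matched n A B a b d" "d \<le> d'" "d' \<le> n"
  shows "basis_partially_matched n A B a b d'"
proof -
  obtain P where P: "P \<subseteq> {1..n}" "card P = n - d"
    "\<forall>i\<in>P. (\<lambda>x. inverse (a i) * x) ` A \<inter> B \<subseteq> span (b ` ({1..n} - {i}))"
    using assms(1) unfolding basis_partially_matched_def by blast
  have "n - d' \<le> card P" using P(2) assms(2) by simp
  from obtain_subset_with_card_n[OF this]
  obtain Q where "Q \<subseteq> P" "card Q = n - d'" by metis
  with P(1,3) assms(3) show ?thesis
    unfolding basis_partially_matched_def by (intro conjI exI[of _ Q]) auto
qed

text \<open>A vector in the intersection has zero coordinate at \<open>b i\<close> for every
  \<open>i \<in> J \<inter> P\<close>. The dimension is thus at most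
  \<open>n - card (J \<inter> P)\<close>, and \<open>card (J \<inter> P)\<close> is at least
  \<open>card J - d\<close>.\<close>

lemma matched_imp_card_dim_le:
  assumes b: "ordered_basis n B b" and m: "basis_partially_matched n A B a b d"
    and J: "J \<subseteq> {1..n}"
  shows "card J + dim (B \<inter> (\<Inter>i\<in>J. T A B a i)) \<le> n + d"
proof -
  obtain P where P: "P \<subseteq> {1..n}" "card P = n - d"
    "\<And>i. i \<in> P \<Longrightarrow> T A B a i \<subseteq> span (b ` ({1..n} - {i}))"
    and d: "d \<le> n"
    using m unfolding basis_partially_matched_def T_def by blast
  let ?Q = "J \<inter> P"
  have inj: "inj_on b {1..n}" and ind: "independent (b ` {1..n})" and sp: "span (b ` {1..n}) = B"
    using b unfolding ordered_basis_def by auto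
  have "B \<inter> (\<Inter>i\<in>J. T A B a i) \<subseteq> span (b ` {1..n} - b ` ?Q)"
  proof
    fix x assume x: "x \<in> B \<inter> (\<Inter>i\<in>J. T A B a i)"
    show "x \<in> span (b ` {1..n} - b ` ?Q)"
    proof (rule in_span_Diff[OF ind])
      show "finite (b ` ?Q)" using J finite_subset by blast
      show "x \<in> span (b ` {1..n})" using x sp by auto
      fix y assume "y \<in> b ` ?Q"
      then obtain i where i: "i \<in> J" "i \<in> P" "y = b i" by auto
      have "b ` ({1..n} - {i}) = b ` {1..n} - {y}"
        using i P(1) inj by (subst inj_on_image_set_diff[OF inj]) auto
      then show "x \<in> span (b ` {1..n} - {y})" using P(3)[OF i(2)] x i(1) by auto
    qed
  qed
  moreover have "b ` {1..n} - b ` ?Q = b ` ({1..n} - ?Q)"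
    using J by (subst inj_on_image_set_diff[OF inj]) auto
  ultimately have "dim (B \<inter> (\<Inter>i\<in>J. T A B a i)) \<le> card (b ` ({1..n} - ?Q))"
    by (intro dim_le_card) auto
  also have "\<dots> = card ({1..n} - ?Q)" using card_ordered_basis_image[OF b] by auto
  also have "\<dots> = n - card ?Q" using J by (subst card_Diff_subset) (auto intro: finite_subset)
  finally have "dim (B \<inter> (\<Inter>i\<in>J. T A B a i)) \<le> n - card ?Q" .
  moreover have "card ?Q \<le> n" using card_mono[of "{1..n}" ?Q] J by auto
  moreover have "card J + card P \<le> n + card ?Q"
  proof -
    have "card J + card P = card (J \<union> P) + card ?Q"
      using J P(1) by (intro card_Un_Int) (auto intro: finite_subset)
    moreover have "card (J \<union> P) \<le> n" using card_mono[of "{1..n}" "J \<union> P"] J P(1) by auto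
    ultimately show ?thesis by simp
  qed
  ultimately show ?thesis using P(2) d by linarith
qed

text \<open>The dual basis of the enlarged subspaces \<open>H i\<close> serves for the smaller
  \<open>T i\<close> as well. Its part \<open>C\<close> has as many elements as the defect that it
  realizes.\<close>

lemma card_dim_le_imp_matched:
  assumes A: "subspace A" and B: "subspace B" "dim B = n" "0 < n" and d: "d \<le> n"
    and c: "\<And>J. J \<subseteq> {1..n} \<Longrightarrow> card J + dim (B \<inter> (\<Inter>i\<in>J. T A B a i)) \<le> n + d"
  shows "\<exists>b. ordered_basis n B b \<and> basis_partially_matched n A B a b d"
proof -
  obtain e where e: "ordered_basis n B e" using ordered_basis_exists B by blast
  have F: "B \<subseteq> span (e ` {1..n})" "finite (e ` {1..n})"
    using e unfolding ordered_basis_def by auto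
  have "\<exists>H. (\<forall>i\<in>{1..n}. subspace (H i) \<and> T A B a i \<subseteq> H i \<and> H i \<subseteq> B \<and>
        (\<forall>y\<in>B - H i. B \<subseteq> span (insert y (H i))))
      \<and> card {1..n} + dim (B \<inter> (\<Inter>i\<in>{1..n}. H i)) \<le> n + d"
    by (rule enlarge_to_hyperplanes[OF B(1) F finite_atLeastAtMost subspace_T[OF A B(1)] T_subset c])
  then obtain H where H: "\<And>i. i \<in> {1..n} \<Longrightarrow> subspace (H i)" "\<And>i. i \<in> {1..n} \<Longrightarrow> T A B a i \<subseteq> H i"
    "\<And>i. i \<in> {1..n} \<Longrightarrow> H i \<subseteq> B"
    "\<And>i y. i \<in> {1..n} \<Longrightarrow> y \<in> B - H i \<Longrightarrow> B \<subseteq> span (insert y (H i))"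
    "card {1..n} + dim (B \<inter> (\<Inter>i\<in>{1..n}. H i)) \<le> n + d"
    by blast
  obtain P b C where P: "P \<subseteq> {1..n}" "inj_on b P" "b ` P \<inter> C = {}" "finite C"
    "independent (b ` P \<union> C)" "span (b ` P \<union> C) = B"
    "card C = dim (B \<inter> (\<Inter>i\<in>{1..n}. H i))" "\<And>i. i \<in> P \<Longrightarrow> H i \<subseteq> span (b ` (P - {i}) \<union> C)"
  proof (rule hyperplanes_dual_basis[where H = H, OF B(1) F finite_atLeastAtMost[of 1 n]])
    show "subspace (H i)" "H i \<subseteq> B" if "i \<in> {1..n}" for i using H(1,3) that by blast+
    show "B \<subseteq> span (insert y (H i))" if "i \<in> {1..n}" "y \<in> B - H i" for i y using H(4) that by blast
  qed (rule that)
  have finP: "finite P" using P(1) finite_subset by blast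
  have "card (b ` P \<union> C) = n"
    using P(5,6) B(2) dim_span_eq_card_independent by metis
  then have nPC: "card P + card C = n"
    using P(2,3,4) finP by (simp add: card_Un_disjoint card_image)
  then have "card ({1..n} - P) = card C"
    using P(1) finP by (simp add: card_Diff_subset)
  \<comment> \<open>Each \<open>b i\<close> must keep its own index, so \<open>C\<close> is numbered
    by the indices outside \<open>P\<close>.\<close>
  then obtain g where g: "bij_betw g ({1..n} - P) C"
    using P(4) by (metis bij_betw_iff_card finite_Diff finite_atLeastAtMost)
  define f where "f i = (if i \<in> P then b i else g i)" for i
  have fC: "f ` ({1..n} - P) = C" "inj_on f ({1..n} - P)"
    using g unfolding f_def bij_betw_def inj_on_def by auto
  have fP: "f ` Q = b ` Q" if "Q \<subseteq> P" for Q using that unfolding f_def by force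
  have split: "{1..n} = P \<union> ({1..n} - P)" using P(1) by auto
  have fim: "f ` {1..n} = b ` P \<union> C" using fP[of P] fC by (subst split) (simp only: image_Un)
  have "inj_on f P" using P(2) unfolding f_def inj_on_def by auto
  then have "inj_on f (P \<union> ({1..n} - P))"
    using fC fP[of P] P(3) unfolding inj_on_Un by auto
  then have ob: "ordered_basis n B f"
    unfolding ordered_basis_def using split fim P(5,6) by metis
  have incl: "(\<lambda>x. inverse (a i) * x) ` A \<inter> B \<subseteq> span (f ` ({1..n} - {i}))" if i: "i \<in> P" for i
  proof -
    have "{1..n} - {i} = (P - {i}) \<union> ({1..n} - P)" using i P(1) by auto
    then have "f ` ({1..n} - {i}) = b ` (P - {i}) \<union> C"
      using fP[of "P - {i}"] fC(1) by (metis Diff_subset image_Un)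
    moreover have "T A B a i \<subseteq> H i" using H(2) P(1) i by blast
    ultimately show ?thesis using P(8)[OF i] unfolding T_def by simp
  qed
  \<comment> \<open>This is the bound for the full index set,
    \<open>n + card C \<le> n + d\<close>.\<close>
  have "card C \<le> d" using H(5) P(7) by simp
  moreover have "basis_partially_matched n A B a f (card C)"
    unfolding basis_partially_matched_def using P(1) incl nPC by (intro conjI exI[of _ P]) auto
  ultimately have "basis_partially_matched n A B a f d"
    using basis_partially_matched_mono d by blast
  with ob show ?thesis by blast
qed

section \<open>The maximum \<open>\<Omega>\<close> as least defect, and the deficiency\<close>

lemma \<Omega>_le_iff:
  "\<Omega> n A B a \<le> int d \<longleftrightarrow>
     (\<forall>J\<subseteq>{1..n}. card J + dim (B \<inter> (\<Inter>i\<in>J. T A B a i)) \<le> n + d)"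
proof -
  have *: "int (card J) + int (dim (B \<inter> (\<Inter>i\<in>J. T A B a i))) - int n \<le> int d \<longleftrightarrow>
      card J + dim (B \<inter> (\<Inter>i\<in>J. T A B a i)) \<le> n + d" for J
    by linarith
  show ?thesis
    unfolding \<Omega>_def Inter_T_eq by (subst Max_le_iff) (auto simp: * simp flip: Pow_iff)
qed

text \<open>The term for \<open>J = {}\<close> is \<open>dim B - n = 0\<close>.\<close>

lemma \<Omega>_nonneg:
  assumes "dim B = n"
  shows "0 \<le> \<Omega> n A B a"
  unfolding \<Omega>_def Inter_T_eq by (rule Max_ge) (use assms in \<open>force+\<close>)

text \<open>The attainable defects form the whole interval from \<open>\<Omega>\<close> to
  \<open>n\<close>, which yields both parts of the theorem.\<close>

lemma matched_iff_\<Omega>_le: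
  assumes "subspace A" "subspace B" "dim B = n" "0 < n"
  shows "(\<exists>b. ordered_basis n B b \<and> basis_partially_matched n A B a b d) \<longleftrightarrow>
           \<Omega> n A B a \<le> int d \<and> d \<le> n"
proof
  assume "\<exists>b. ordered_basis n B b \<and> basis_partially_matched n A B a b d"
  then obtain b where b: "ordered_basis n B b" "basis_partially_matched n A B a b d" by blast
  then have "d \<le> n" unfolding basis_partially_matched_def by blast
  with matched_imp_card_dim_le[OF b] show "\<Omega> n A B a \<le> int d \<and> d \<le> n"
    unfolding \<Omega>_le_iff by blast
qed (use card_dim_le_imp_matched[OF assms] in \<open>auto simp: \<Omega>_le_iff\<close>)

text \<open>Defect \<open>n\<close> is always attained, with \<open>P = {}\<close>, and an attained
  defect bounds \<open>\<Omega>\<close>.\<close>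

lemma \<Omega>_le:
  assumes "subspace B" "dim B = n" "0 < n"
  shows "\<Omega> n A B a \<le> int n"
proof -
  obtain b where "ordered_basis n B b" using ordered_basis_exists assms by blast
  moreover have "basis_partially_matched n A B a b n"
    unfolding basis_partially_matched_def by (intro conjI exI[of _ "{}"]) auto
  ultimately show ?thesis using matched_imp_card_dim_le unfolding \<Omega>_le_iff by blast
qed

lemma deficiency_eq_Max_\<Omega>:
  assumes A: "subspace A" "dim A = n" and B: "subspace B" "dim B = n" "0 < n"
  shows "int (deficiency n A B) = Max {\<Omega> n A B a | a. ordered_basis n A a}"
proof -
  let ?S = "{\<Omega> n A B a | a. ordered_basis n A a}"
  \<comment> \<open>There may be infinitely many ordered bases; the bounds on the values make
    \<open>Max\<close> meaningful.\<close>
  have "?S \<subseteq> {0..int n}" using \<Omega>_nonneg[OF B(2)] \<Omega>_le[OF B] by auto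
  then have fin: "finite ?S" by (rule finite_subset) simp
  have ne: "?S \<noteq> {}" using ordered_basis_exists A B(3) by blast
  then have Max: "Max ?S \<in> {0..int n}" using Max_in[OF fin] \<open>?S \<subseteq> _\<close> by blast
  have pm: "partially_matched n A B d \<longleftrightarrow> Max ?S \<le> int d \<and> d \<le> n" for d
  proof -
    have "partially_matched n A B d \<longleftrightarrow> (\<forall>w\<in>?S. w \<le> int d \<and> d \<le> n)"
      unfolding partially_matched_def matched_iff_\<Omega>_le[OF A(1) B] by blast
    \<comment> \<open>Nonemptiness also lets \<open>d \<le> n\<close> be extracted from the
      quantifier over \<open>?S\<close>.\<close>
    then show ?thesis using Max_le_iff[OF fin ne] ne by blast
  qed
  have "deficiency n A B = nat (Max ?S)"
    unfolding deficiency_def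
  proof (rule Least_equality)
    show "partially_matched n A B (nat (Max ?S))"
      unfolding pm using Max by (simp add: nat_le_iff del: Max_le_iff)
    show "nat (Max ?S) \<le> d" if "partially_matched n A B d" for d
      using that unfolding pm nat_le_iff by (rule conjunct1)
  qed
  then show ?thesis using Max by simp
qed

end

theorem theorem3p11:
  fixes emb :: "'k::field \<Rightarrow> 'l::field"
    and A B :: "'l set"
    and n :: nat
  assumes "field_extension emb"
    and "range emb \<noteq> UNIV"
    and "module.subspace (ext_scale emb) A"
    and "module.subspace (ext_scale emb) B"
    and "vector_space.dim (ext_scale emb) A = n"
    and "vector_space.dim (ext_scale emb) B = n"
    and "0 < n"
    and "1 \<notin> B"
  shows "(\<forall>a. field_extension.ordered_basis emb n A a \<longrightarrow>
            (\<exists>d::nat. field_extension.\<Omega> emb n A B a = int d \<and>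
               (\<exists>b. field_extension.ordered_basis emb n B b \<and>
                    field_extension.basis_partially_matched emb n A B a b d) \<and>
               (\<forall>d'. (\<exists>b. field_extension.ordered_basis emb n B b \<and>
                          field_extension.basis_partially_matched emb n A B a b d')
                     \<longrightarrow> d \<le> d'))) \<and>
         int (field_extension.deficiency emb n A B) =
           Max {field_extension.\<Omega> emb n A B a | a. field_extension.ordered_basis emb n A a}"
proof -
  interpret field_extension emb by (rule assms(1))
  note B = assms(4,6,7)
  \<comment> \<open>This natural number lies in the interval of attainable defects and is its lower
    end.\<close>
  have "\<exists>d::nat. \<Omega> n A B a = int d \<and> d \<le> n" for a
    using \<Omega>_nonneg[OF B(2)] \<Omega>_le[OF B] by (metis int_nat_eq of_nat_le_iff)
  then show ?thesis
    unfolding matched_iff_\<Omega>_le[OF assms(3) B]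
    using deficiency_eq_Max_\<Omega>[OF assms(3,5) B] by (metis of_nat_le_iff order_refl)
qed

end
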